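(* Let $(X,\mathcal{T}_1,\mathcal{T}_2,E)$ be a bi-soft topological space over $X$. If $(X,\mathcal{T}_1,\mathcal{T}_2,E)$ is a pair-wise soft $T_2$-space, then $(X,\mathcal{T}_1\vee\mathcal{T}_2,E)$ is also a soft $T_2$-space.
   Context: $X$ is a set (initial universe) and $E$ is a non-empty set of parameters. A soft set $(F,E)$ over $X$ is a map $F:E\to\mathcal{P}(X)$, where $\mathcal{P}(X)$ is the power set of $X$. Unions and intersections of soft sets are taken parameterwise. $\Phi$ denotes the soft set with value $\emptyset$ at every $e\in E$ and $\widetilde{X}$ the soft set with value $X$ at every $e\in E$. For $x\in X$, $x\in(F,E)$ means $x\in F(e)$ for all $e\in E$. A soft topology on $X$ is a collection $\mathcal{T}$ of soft sets over $X$ (with parameter set $E$) containing $\Phi$ and $\widetilde{X}$ and closed under arbitrary unions and under intersections of two members; $(X,\mathcal{T},E)$ is then a soft topological space and members of $\mathcal{T}$ are called soft open. A bi-soft topological space $(X,\mathcal{T}_1,\mathcal{T}_2,E)$ consists of two soft topologies $\mathcal{T}_1,\mathcal{T}_2$ on $X$ with the same parameter set $E$. $\mathcal{T}_1\vee\mathcal{T}_2$ denotes the smallest soft topology on $X$ containing $\mathcal{T}_1\cup\mathcal{T}_2$. $(X,\mathcal{T},E)$ is a soft $T_2$-space if for all $x,y\in X$ with $x\neq y$ there are $(F,E),(G,E)\in\mathcal{T}$ with $x\in(F,E)$, $y\in(G,E)$ and $(F,E)\cap(G,E)=\Phi$. $(X,\mathcal{T}_1,\mathcal{T}_2,E)$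 is pair-wise soft $T_2$ (pair-wise soft Hausdorff) if for all $x,y\in X$ with $x\ne y$ there are $(F,E)\in\mathcal{T}_1$ and $(G,E)\in\mathcal{T}_2$ with $x\in(F,E)$, $y\in(G,E)$ and $(F,E)\cap(G,E)=\Phi$. *)

theory Defs
  imports "HOL-Library.FuncSet"
begin

text \<open>A soft set over \<open>X\<close> with parameter set \<open>E\<close> is an extensional function on \<open>E\<close>
  (arbitrary fixed value outside \<open>E\<close>), so that HOL equality of soft sets is equality as maps
  from \<open>E\<close> to the power set of \<open>X\<close>. All operations are therefore restricted to \<open>E\<close>.\<close>

definition soft_sets :: "'a set \<Rightarrow> 'e set \<Rightarrow> ('e \<Rightarrow> 'a set) set" where
  "soft_sets X E = E \<rightarrow>\<^sub>E Pow X"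

definition soft_null :: "'e set \<Rightarrow> 'e \<Rightarrow> 'a set" where
  "soft_null E = (\<lambda>e\<in>E. {})"

definition soft_whole :: "'a set \<Rightarrow> 'e set \<Rightarrow> 'e \<Rightarrow> 'a set" where
  "soft_whole X E = (\<lambda>e\<in>E. X)"

definition soft_Union :: "'e set \<Rightarrow> ('e \<Rightarrow> 'a set) set \<Rightarrow> 'e \<Rightarrow> 'a set" where
  "soft_Union E \<F> = (\<lambda>e\<in>E. \<Union>F\<in>\<F>. F e)"

definition soft_Int :: "'e set \<Rightarrow> ('e \<Rightarrow> 'a set) \<Rightarrow> ('e \<Rightarrow> 'a set) \<Rightarrow> 'e \<Rightarrow> 'a set" where
  "soft_Int E F G = (\<lambda>e\<in>E. F e \<inter> G e)"

definition soft_mem :: "'e set \<Rightarrow> 'a \<Rightarrow> ('e \<Rightarrow> 'a set) \<Rightarrow> bool" where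
  "soft_mem E x F \<longleftrightarrow> (\<forall>e\<in>E. x \<in> F e)"

definition soft_topological_space :: "'a set \<Rightarrow> ('e \<Rightarrow> 'a set) set \<Rightarrow> 'e set \<Rightarrow> bool" where
  "soft_topological_space X T E \<longleftrightarrow>
     E \<noteq> {} \<and>
     T \<subseteq> soft_sets X E \<and>
     soft_null E \<in> T \<and>
     soft_whole X E \<in> T \<and>
     (\<forall>\<F>. \<F> \<subseteq> T \<longrightarrow> soft_Union E \<F> \<in> T) \<and>
     (\<forall>F\<in>T. \<forall>G\<in>T. soft_Int E F G \<in> T)"

definition bi_soft_topological_space ::
  "'a set \<Rightarrow> ('e \<Rightarrow> 'a set) set \<Rightarrow> ('e \<Rightarrow> 'a set) set \<Rightarrow> 'e set \<Rightarrow> bool" where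
  "bi_soft_topological_space X T1 T2 E \<longleftrightarrow>
     soft_topological_space X T1 E \<and> soft_topological_space X T2 E"

definition soft_join ::
  "'a set \<Rightarrow> 'e set \<Rightarrow> ('e \<Rightarrow> 'a set) set \<Rightarrow> ('e \<Rightarrow> 'a set) set \<Rightarrow> ('e \<Rightarrow> 'a set) set" where
  "soft_join X E T1 T2 = \<Inter>{T. soft_topological_space X T E \<and> T1 \<union> T2 \<subseteq> T}"

definition soft_T2_space :: "'a set \<Rightarrow> ('e \<Rightarrow> 'a set) set \<Rightarrow> 'e set \<Rightarrow> bool" where
  "soft_T2_space X T E \<longleftrightarrow>
     soft_topological_space X T E \<and>
     (\<forall>x\<in>X. \<forall>y\<in>X. x \<noteq> y \<longrightarrow>
        (\<exists>F\<in>T. \<exists>G\<in>T. soft_mem E x F \<and> soft_mem E y G \<and> soft_Int E F G = soft_null E))"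

definition pairwise_soft_T2_space ::
  "'a set \<Rightarrow> ('e \<Rightarrow> 'a set) set \<Rightarrow> ('e \<Rightarrow> 'a set) set \<Rightarrow> 'e set \<Rightarrow> bool" where
  "pairwise_soft_T2_space X T1 T2 E \<longleftrightarrow>
     bi_soft_topological_space X T1 T2 E \<and>
     (\<forall>x\<in>X. \<forall>y\<in>X. x \<noteq> y \<longrightarrow>
        (\<exists>F\<in>T1. \<exists>G\<in>T2. soft_mem E x F \<and> soft_mem E y G \<and> soft_Int E F G = soft_null E))"

text \<open>The intersection defining \<^const>\<open>soft_join\<close> is over a non-empty family, and it is
  indeed the smallest soft topology containing both given ones.\<close>

lemma soft_topological_space_discrete:
  assumes "E \<noteq> {}"
  shows "soft_topological_space X (soft_sets X E) E"
  using assms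
  by (fastforce simp: soft_topological_space_def soft_sets_def soft_null_def soft_whole_def
      soft_Union_def soft_Int_def PiE_iff)

lemma soft_join_topological_space:
  assumes "bi_soft_topological_space X T1 T2 E"
  shows "soft_topological_space X (soft_join X E T1 T2) E"
proof -
  have ne: "E \<noteq> {}" and sub: "T1 \<union> T2 \<subseteq> soft_sets X E"
    using assms by (auto simp: bi_soft_topological_space_def soft_topological_space_def)
  have "soft_join X E T1 T2 \<subseteq> soft_sets X E"
    using soft_topological_space_discrete[OF ne, of X] sub unfolding soft_join_def by blast
  moreover have "soft_Union E \<F> \<in> soft_join X E T1 T2" if "\<F> \<subseteq> soft_join X E T1 T2" for \<F>
    unfolding soft_join_def
  proof (rule InterI)
    fix T assume "T \<in> {T. soft_topological_space X T E \<and> T1 \<union> T2 \<subseteq> T}"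
    moreover from this have "\<F> \<subseteq> T" using that unfolding soft_join_def by blast
    ultimately show "soft_Union E \<F> \<in> T" by (simp add: soft_topological_space_def)
  qed
  ultimately show ?thesis
    using ne unfolding soft_topological_space_def[of X "soft_join X E T1 T2"]
    by (auto simp: soft_join_def soft_topological_space_def)
qed

lemma soft_join_upper: "T1 \<union> T2 \<subseteq> soft_join X E T1 T2"
  by (auto simp: soft_join_def)

lemma soft_join_least:
  assumes "soft_topological_space X T E" "T1 \<union> T2 \<subseteq> T"
  shows "soft_join X E T1 T2 \<subseteq> T"
  using assms by (auto simp: soft_join_def)

end

theory Submission
  imports Defs
begin

text \<open>The pairwise condition already separates two points by a member of \<open>T1\<close> and a member of
  \<open>T2\<close>. The join contains both topologies, so the same two soft sets separate the points there;
  disjointness and membership of points do not depend on the topology.\<close>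

theorem proposition13:
  fixes X :: "'a set" and E :: "'e set" and T1 T2 :: "('e \<Rightarrow> 'a set) set"
  assumes "bi_soft_topological_space X T1 T2 E"
    and "pairwise_soft_T2_space X T1 T2 E"
  shows "soft_T2_space X (soft_join X E T1 T2) E"
  unfolding soft_T2_space_def
proof (intro conjI ballI impI)
  show "soft_topological_space X (soft_join X E T1 T2) E"
    by (rule soft_join_topological_space[OF assms(1)])
next
  fix x y assume "x \<in> X" "y \<in> X" "x \<noteq> y"
  then obtain F G where "F \<in> T1" "G \<in> T2"
    and sep: "soft_mem E x F" "soft_mem E y G" "soft_Int E F G = soft_null E"
    using assms(2) unfolding pairwise_soft_T2_space_def by blast
  then have "F \<in> soft_join X E T1 T2" "G \<in> soft_join X E T1 T2"
    using soft_join_upper[of T1 T2 X E] by auto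
  with sep show "\<exists>F\<in>soft_join X E T1 T2. \<exists>G\<in>soft_join X E T1 T2.
      soft_mem E x F \<and> soft_mem E y G \<and> soft_Int E F G = soft_null E"
    by blast
qed

end
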